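(* Consider the cheap-talk signaling game with evidence with detector rates $0\le\alpha<\beta\le 1$, $\beta\neq 1-\alpha$, and prior $p=p(1)\in[0,1]$. Let $$T_1=\frac{\alpha\Delta_0^R}{\alpha\Delta_0^R+\beta\Delta_1^R},\quad T_2=\frac{(1-\beta)\Delta_0^R}{(1-\beta)\Delta_0^R+(1-\alpha)\Delta_1^R},\quad T_3=\frac{(1-\alpha)\Delta_0^R}{(1-\alpha)\Delta_0^R+(1-\beta)\Delta_1^R},\quad T_4=\frac{\beta\Delta_0^R}{\beta\Delta_0^R+\alpha\Delta_1^R}.$$ For $m\in\{0,1\}$ and $a\in\{0,1\}$, say that "the pair ($S$ pools on $m$, $R$ plays $a$) is supported" if the profile $\sigma^{S*}(m\,|\,0)=\sigma^{S*}(m\,|\,1)=1$, $\sigma^{R*}(a\,|\,m',e)=1$ for all $m',e\in\{0,1\}$, together with beliefs given by Bayes' law on the equilibrium path and any off-path beliefs satisfying $\mu^R(\theta=a\,|\,1-m,e)\ge \Delta_{1-a}^R/(\Delta_{1-a}^R+\Delta_a^R)$ for all $e\in\{0,1\}$, is a PBNE. Say that "pooling on $m$ is not supported" if there is no PBNE in which $\sigma^{S*}(m\,|\,0)=\sigma^{S*}(m\,|\,1)=1$. (A) If $\beta<1-\alpha$, then: (i) (Zero-Dominant) if $p<T_1$, the pairs ($S$ pools on $0$, $R$ plays $0$) and ($S$ pools on $1$, $R$ plays $0$) are both supported; (ii) (Zero-Heavy) if $T_1<p<T_2$, the pair ($S$ pools on $1$, $R$ plays $0$) is supported, and pooling on $0$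 is not supported; (iii) (Middle) if $T_2<p<T_3$, neither pooling on $0$ nor pooling on $1$ is supported; (iv) (One-Heavy) if $T_3<p<T_4$, the pair ($S$ pools on $0$, $R$ plays $1$) is supported, and pooling on $1$ is not supported; (v) (One-Dominant) if $p>T_4$, the pairs ($S$ pools on $0$, $R$ plays $1$) and ($S$ pools on $1$, $R$ plays $1$) are both supported. (B) If $\beta>1-\alpha$, then: (i) (Zero-Dominant) if $p<T_2$, the pairs ($S$ pools on $0$, $R$ plays $0$) and ($S$ pools on $1$, $R$ plays $0$) are both supported; (ii) (Zero-Heavy) if $T_2<p<T_1$, the pair ($S$ pools on $0$, $R$ plays $0$) is supported, and pooling on $1$ is not supported; (iii) (Middle) if $T_1<p<T_4$, neither pooling on $0$ nor pooling on $1$ is supported; (iv) (One-Heavy) if $T_4<p<T_3$, the pair ($S$ pools on $1$, $R$ plays $1$) is supported, and pooling on $0$ is not supported; (v) (One-Dominant) if $p>T_3$, the pairs ($S$ pools on $0$, $R$ plays $1$) and ($S$ pools on $1$, $R$ plays $1$) are both supported.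
   Context: Cheap-talk signaling game with evidence. Players: a sender $S$ and a receiver $R$. The type $\theta\in\{0,1\}$ is drawn with prior $p(\theta)$, where $p(0)+p(1)=1$. Knowing $\theta$, $S$ sends $m\in\{0,1\}$ according to a mixed strategy $\sigma^S(m\,|\,\theta)$. A detector then emits evidence $e\in\{0,1\}$ with probability $\lambda(e\,|\,\theta,m)$, where $\lambda(1\,|\,\theta,m)=\beta$ if $m\ne\theta$ and $\lambda(1\,|\,\theta,m)=\alpha$ if $m=\theta$ (and $\lambda(0\,|\,\theta,m)=1-\lambda(1\,|\,\theta,m)$). $R$ observes $(m,e)$ (not $\theta$) and plays $a\in\{0,1\}$ according to a mixed strategy $\sigma^R(a\,|\,m,e)$. Utilities $u^S(\theta,m,a),u^R(\theta,m,a)\in\mathbb{R}$ satisfy: neither depends on $m$; $u^R(0,m,0)>u^R(0,m,1)$ and $u^R(1,m,1)>u^R(1,m,0)$; $u^S(0,m,0)<u^S(0,m,1)$ and $u^S(1,m,0)>u^S(1,m,1)$. Put $\Delta_0^R=u^R(0,m,0)-u^R(0,m,1)>0$ and $\Delta_1^R=u^R(1,m,1)-u^R(1,m,0)>0$. A perfect Bayesian Nash equilibrium (PBNE) is a triple $(\sigma^{S*},\sigma^{R*},\mu^R)$, with $\mu^R(\cdot\,|\,m,e)$ a probability distribution on $\{0,1\}$ for each $(m,e)$, such that: (1) for each $\theta$, $\sigma^{S*}$ maximizes over $\sigma^S$ the quantity $\sum_{a,e,m}\sigma^{R*}(a\,|\,m,e)\lambda(e\,|\,\theta,m)\sigma^S(m\,|\,\theta)u^S(\theta,m,a)$;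 (2) for each $(m,e)$, $\sigma^{R*}$ maximizes over $\sigma^R$ the quantity $\sum_\theta\mu^R(\theta\,|\,m,e)\sum_a\sigma^R(a\,|\,m,e)u^R(\theta,m,a)$; (3) whenever $\sum_{\tilde\theta}\lambda(e\,|\,\tilde\theta,m)\sigma^{S*}(m\,|\,\tilde\theta)p(\tilde\theta)>0$, $\mu^R(\theta\,|\,m,e)=\lambda(e\,|\,\theta,m)\sigma^{S*}(m\,|\,\theta)p(\theta)/\sum_{\tilde\theta}\lambda(e\,|\,\tilde\theta,m)\sigma^{S*}(m\,|\,\tilde\theta)p(\tilde\theta)$ (Bayes' law); otherwise $\mu^R(\cdot\,|\,m,e)$ is arbitrary. When both types send $m$ with probability one, pairs $(m,e)$ are on the equilibrium path and pairs $(1-m,e)$ are off it. *)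

theory Defs
  imports "HOL-Probability.Probability_Mass_Function" "HOL-Library.Z2"
begin

text \<open>
  Types, messages, evidence and actions all range over the two-element type
  \<^typ>\<open>bit\<close>, whose elements are \<open>0\<close> and \<open>1\<close>; on it, \<open>1 - x\<close> is the element other than \<open>x\<close>.
  Strategies and beliefs are curried: \<open>\<sigma>S \<theta>\<close> is the distribution of the message sent by type
  \<open>\<theta>\<close>, \<open>\<sigma>R m e\<close> that of the receiver's action, and \<open>\<mu> m e\<close> the receiver's belief about the
  type after message \<open>m\<close> and evidence \<open>e\<close>.
  Utilities take their arguments in the order type, message, action.
\<close>

type_synonym sender_strategy = "bit \<Rightarrow> bit pmf"
type_synonym receiver_strategy = "bit \<Rightarrow> bit \<Rightarrow> bit pmf"
type_synonym belief_system = "bit \<Rightarrow> bit \<Rightarrow> bit pmf"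
type_synonym utility = "bit \<Rightarrow> bit \<Rightarrow> bit \<Rightarrow> real"

text \<open>
  Probability of evidence \<open>e\<close> given type \<open>\<theta>\<close> and message \<open>m\<close>; \<open>\<alpha>\<close> is the false-alarm rate
  on truthful messages, \<open>\<beta>\<close> the detection rate on lies.
\<close>

definition detector :: "real \<Rightarrow> real \<Rightarrow> bit \<Rightarrow> bit \<Rightarrow> bit \<Rightarrow> real" where
  "detector \<alpha> \<beta> e \<theta> m =
     (let r = (if m = \<theta> then \<alpha> else \<beta>) in if e = 1 then r else 1 - r)"

definition sender_payoff ::
    "real \<Rightarrow> real \<Rightarrow> utility \<Rightarrow> receiver_strategy \<Rightarrow> bit \<Rightarrow> sender_strategy \<Rightarrow> real" where
  "sender_payoff \<alpha> \<beta> uS \<sigma>R \<theta> \<sigma>S =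
     (\<Sum>a\<in>{0, 1}. \<Sum>e\<in>{0, 1}. \<Sum>m\<in>{0, 1}.
        pmf (\<sigma>R m e) a * detector \<alpha> \<beta> e \<theta> m * pmf (\<sigma>S \<theta>) m * uS \<theta> m a)"

definition receiver_payoff ::
    "utility \<Rightarrow> belief_system \<Rightarrow> bit \<Rightarrow> bit \<Rightarrow> receiver_strategy \<Rightarrow> real" where
  "receiver_payoff uR \<mu> m e \<sigma>R =
     (\<Sum>\<theta>\<in>{0, 1}. pmf (\<mu> m e) \<theta> * (\<Sum>a\<in>{0, 1}. pmf (\<sigma>R m e) a * uR \<theta> m a))"

definition observation_prob ::
    "bit pmf \<Rightarrow> real \<Rightarrow> real \<Rightarrow> sender_strategy \<Rightarrow> bit \<Rightarrow> bit \<Rightarrow> real" where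
  "observation_prob prior \<alpha> \<beta> \<sigma>S m e =
     (\<Sum>\<theta>\<in>{0, 1}. detector \<alpha> \<beta> e \<theta> m * pmf (\<sigma>S \<theta>) m * pmf prior \<theta>)"

definition bayes_consistent_at ::
    "bit pmf \<Rightarrow> real \<Rightarrow> real \<Rightarrow> sender_strategy \<Rightarrow> belief_system \<Rightarrow> bit \<Rightarrow> bit \<Rightarrow> bool" where
  "bayes_consistent_at prior \<alpha> \<beta> \<sigma>S \<mu> m e \<longleftrightarrow>
     (observation_prob prior \<alpha> \<beta> \<sigma>S m e > 0 \<longrightarrow>
       (\<forall>\<theta>. pmf (\<mu> m e) \<theta> =
          detector \<alpha> \<beta> e \<theta> m * pmf (\<sigma>S \<theta>) m * pmf prior \<theta> / observation_prob prior \<alpha> \<beta> \<sigma>S m e))"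

definition PBNE ::
    "bit pmf \<Rightarrow> real \<Rightarrow> real \<Rightarrow> utility \<Rightarrow> utility \<Rightarrow>
     sender_strategy \<Rightarrow> receiver_strategy \<Rightarrow> belief_system \<Rightarrow> bool" where
  "PBNE prior \<alpha> \<beta> uS uR \<sigma>S \<sigma>R \<mu> \<longleftrightarrow>
     (\<forall>\<theta> \<sigma>S'. sender_payoff \<alpha> \<beta> uS \<sigma>R \<theta> \<sigma>S' \<le> sender_payoff \<alpha> \<beta> uS \<sigma>R \<theta> \<sigma>S) \<and>
     (\<forall>m e \<sigma>R'. receiver_payoff uR \<mu> m e \<sigma>R' \<le> receiver_payoff uR \<mu> m e \<sigma>R) \<and>
     (\<forall>m e. bayes_consistent_at prior \<alpha> \<beta> \<sigma>S \<mu> m e)"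

definition pools_on :: "sender_strategy \<Rightarrow> bit \<Rightarrow> bool" where
  "pools_on \<sigma>S m \<longleftrightarrow> (\<forall>\<theta>. pmf (\<sigma>S \<theta>) m = 1)"

text \<open>
  The receiver's gain from matching the type \<open>\<theta>\<close>. It is evaluated at message \<open>0\<close>; it is only
  used for utilities that do not depend on the message.
\<close>

definition receiver_gain :: "utility \<Rightarrow> bit \<Rightarrow> real" where
  "receiver_gain uR \<theta> = uR \<theta> 0 \<theta> - uR \<theta> 0 (1 - \<theta>)"

text \<open>
  Every belief system that obeys Bayes' law after message \<open>m\<close> and meets the threshold after
  message \<open>1 - m\<close> is required to complete the profile to an equilibrium.
\<close>

definition pooling_supported ::
    "bit pmf \<Rightarrow> real \<Rightarrow> real \<Rightarrow> utility \<Rightarrow> utility \<Rightarrow> bit \<Rightarrow> bit \<Rightarrow> bool" where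
  "pooling_supported prior \<alpha> \<beta> uS uR m a \<longleftrightarrow>
     (\<forall>\<sigma>S \<sigma>R \<mu>.
        pools_on \<sigma>S m \<longrightarrow>
        (\<forall>m' e. pmf (\<sigma>R m' e) a = 1) \<longrightarrow>
        (\<forall>e. bayes_consistent_at prior \<alpha> \<beta> \<sigma>S \<mu> m e) \<longrightarrow>
        (\<forall>e. pmf (\<mu> (1 - m) e) a \<ge>
               receiver_gain uR (1 - a) / (receiver_gain uR (1 - a) + receiver_gain uR a)) \<longrightarrow>
        PBNE prior \<alpha> \<beta> uS uR \<sigma>S \<sigma>R \<mu>)"

definition pooling_not_supported ::
    "bit pmf \<Rightarrow> real \<Rightarrow> real \<Rightarrow> utility \<Rightarrow> utility \<Rightarrow> bit \<Rightarrow> bool" where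
  "pooling_not_supported prior \<alpha> \<beta> uS uR m \<longleftrightarrow>
     \<not> (\<exists>\<sigma>S \<sigma>R \<mu>. PBNE prior \<alpha> \<beta> uS uR \<sigma>S \<sigma>R \<mu> \<and> pools_on \<sigma>S m)"

end

theory Submission
  imports Defs
begin

text \<open>
  When both types send \<open>m\<close>, Bayes' law makes the receiver compare the weights
  \<open>\<lambda>(e|\<theta>, m) p(\<theta>) \<Delta>\<^sub>\<theta>\<close> of the two types, and \<open>T\<^sub>1, \<dots>, T\<^sub>4\<close> are the priors at which these balance
  for the four pairs \<open>(m, e)\<close>. If the comparison does not depend on \<open>e\<close>, the receiver's action
  is constant and the sender is indifferent, so pooling is an equilibrium. If it does, the
  receiver trusts the message exactly when there is no alarm, and no response to the other
  message keeps both types from deviating, unless \<open>\<beta> = 1 - \<alpha>\<close>.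
\<close>

text \<open>
  The default simplification rules of \<^typ>\<open>bit\<close> would turn \<open>1 - x\<close> into a parity expression.
\<close>

declare minus_bit_def [simp del] add_bit_eq_xor [simp del]

section \<open>Sums and distributions on two points\<close>

lemma bit_diff_diff [simp]: "1 - (1 - b) = b" for b :: bit
  by (rule diff_eq_eq[THEN iffD2]) (simp add: add.commute)

lemma all_bit: "(\<forall>b :: bit. P b) \<longleftrightarrow> P 0 \<and> P 1"
  by (metis bit.exhaust)

text \<open>The free choice of \<open>b\<close> lets sums be split at the message or action under
  discussion, without a case analysis.\<close>

lemma sum_bit: "(\<Sum>x\<in>{0, 1}. f x) = f b + f (1 - b)" for f :: "bit \<Rightarrow> real" and b :: bit
  by (cases b) auto

lemma pmf_bit_sum: "pmf q b + pmf q (1 - b) = 1" for b :: bit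
proof -
  have "set_pmf q \<subseteq> {0, 1}"
    by (auto simp: bit_not_one_iff)
  then have "(\<Sum>x\<in>{0, 1}. pmf q x) = 1"
    by (rule sum_pmf_eq_1[rotated]) (rule finite.intros)+
  then show ?thesis
    unfolding sum_bit[of _ b] .
qed

lemma pmf_bit_diff: "pmf q (1 - b) = 1 - pmf q b" for b :: bit
  using pmf_bit_sum[of q b] by simp

lemma pmf_bit_zero: "pmf q 0 = 1 - pmf q (1 :: bit)"
  using pmf_bit_sum[of q 1] by simp

text \<open>Clearing the positive denominator. With \<open>v\<close>, \<open>w\<close> the evidence
  probabilities of types 0 and 1 and \<open>x\<close>, \<open>y\<close> the gains, the right-hand
  sides are the weight comparisons in \<open>favours\<close>.\<close>

lemma cutoff_iff:
  fixes v w x y p :: real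
  assumes "0 < v * x + w * y"
  shows "p < v * x / (v * x + w * y) \<longleftrightarrow> w * p * y < v * (1 - p) * x"
    and "v * x / (v * x + w * y) < p \<longleftrightarrow> v * (1 - p) * x < w * p * y"
  using assms by (simp_all add: pos_less_divide_eq pos_divide_less_eq algebra_simps)

text \<open>A cutoff depends on \<open>v\<close> and \<open>w\<close> only through their ratio:
  after cross-multiplication the terms in \<open>v * v'\<close> cancel.\<close>

lemma cutoff_mono:
  fixes v w v' w' x y :: real
  assumes "0 < v * x + w * y" "0 < v' * x + w' * y" "0 < x" "0 < y" "v * w' \<le> v' * w"
  shows "v * x / (v * x + w * y) \<le> v' * x / (v' * x + w' * y)"
proof -
  have "(v * w') * (x * y) \<le> (v' * w) * (x * y)"
    using assms by (intro mult_right_mono) auto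
  then have "v * x * (v' * x + w' * y) \<le> v' * x * (v * x + w * y)"
    by (simp add: algebra_simps)
  then show ?thesis
    using assms by (simp add: frac_le_eq divide_simps)
qed

section \<open>Best responses of receiver and sender\<close>

locale evidence_game =
  fixes \<alpha> \<beta> :: real and uS uR :: utility
  assumes detector_rates: "0 \<le> \<alpha>" "\<alpha> < \<beta>" "\<beta> \<le> 1"
    and uS_message: "uS \<theta> m a = uS \<theta> m' a"
    and uR_message: "uR \<theta> m a = uR \<theta> m' a"
    and receiver_matches: "uR \<theta> m (1 - \<theta>) < uR \<theta> m \<theta>"
    and sender_mismatches: "uS \<theta> m \<theta> < uS \<theta> m (1 - \<theta>)"
begin

abbreviation gain :: "bit \<Rightarrow> real" where
  "gain \<equiv> receiver_gain uR"

lemma gain_pos: "0 < gain \<theta>"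
  using receiver_matches[of \<theta> 0] by (simp add: receiver_gain_def)

lemma detector_nonneg: "0 \<le> detector \<alpha> \<beta> e \<theta> m"
  using detector_rates by (simp add: detector_def Let_def)

lemma detector_sum: "detector \<alpha> \<beta> 0 \<theta> m + detector \<alpha> \<beta> 1 \<theta> m = 1"
  by (simp add: detector_def Let_def)

text \<open>Expected payoff of playing \<open>a\<close> minus that of playing \<open>1 - a\<close>
  when the type has distribution \<open>q\<close>.\<close>

definition advantage :: "bit pmf \<Rightarrow> bit \<Rightarrow> real" where
  "advantage q a = pmf q a * gain a - pmf q (1 - a) * gain (1 - a)"

text \<open>The payoff is affine in the probability of \<open>a\<close> with slope
  \<open>advantage\<close>, whose sign therefore determines the best response.\<close>

lemma receiver_payoff_diff:
  "receiver_payoff uR \<mu> m e \<sigma>' - receiver_payoff uR \<mu> m e \<sigma> =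
     (pmf (\<sigma>' m e) a - pmf (\<sigma> m e) a) * advantage (\<mu> m e) a"
proof -
  have u: "uR \<theta> m b = uR \<theta> 0 b" for \<theta> b
    by (rule uR_message)
  show ?thesis
    unfolding receiver_payoff_def sum_bit[of _ a] advantage_def receiver_gain_def u
      pmf_bit_diff[of "\<sigma>' m e"] pmf_bit_diff[of "\<sigma> m e"]
    by (simp add: algebra_simps)
qed

lemma receiver_optimal:
  assumes "0 \<le> advantage (\<mu> m e) a" and "pmf (\<sigma> m e) a = 1"
  shows "receiver_payoff uR \<mu> m e \<sigma>' \<le> receiver_payoff uR \<mu> m e \<sigma>"
proof -
  have "(pmf (\<sigma>' m e) a - pmf (\<sigma> m e) a) * advantage (\<mu> m e) a \<le> 0"
    using assms by (intro mult_nonpos_nonneg) (auto simp: pmf_le_1)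
  then show ?thesis
    using receiver_payoff_diff[of \<mu> m e \<sigma>' \<sigma> a] by simp
qed

lemma receiver_optimal_imp_pure:
  assumes opt: "\<And>\<sigma>'. receiver_payoff uR \<mu> m e \<sigma>' \<le> receiver_payoff uR \<mu> m e \<sigma>"
    and adv: "0 < advantage (\<mu> m e) a"
  shows "pmf (\<sigma> m e) a = 1"
proof -
  have "(1 - pmf (\<sigma> m e) a) * advantage (\<mu> m e) a \<le> 0"
    using opt[of "\<lambda>_ _. return_pmf a"]
      receiver_payoff_diff[of \<mu> m e "\<lambda>_ _. return_pmf a" \<sigma> a] by simp
  then have "1 \<le> pmf (\<sigma> m e) a"
    using adv by (simp add: mult_le_0_iff)
  then show ?thesis
    using pmf_le_1[of "\<sigma> m e" a] by linarith
qed

text \<open>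
  Both types want the receiver to mismatch, so up to a positive affine transformation the
  payoff of type \<open>\<theta>\<close> is the probability of action \<open>1 - \<theta>\<close>.
\<close>

definition deception_prob :: "receiver_strategy \<Rightarrow> bit \<Rightarrow> bit \<Rightarrow> real" where
  "deception_prob \<sigma>R \<theta> m = (\<Sum>e\<in>{0, 1}. detector \<alpha> \<beta> e \<theta> m * pmf (\<sigma>R m e) (1 - \<theta>))"

lemma sender_payoff_eq:
  "sender_payoff \<alpha> \<beta> uS \<sigma>R \<theta> \<sigma>S =
     uS \<theta> 0 \<theta> + (uS \<theta> 0 (1 - \<theta>) - uS \<theta> 0 \<theta>) *
       (\<Sum>m\<in>{0, 1}. pmf (\<sigma>S \<theta>) m * deception_prob \<sigma>R \<theta> m)"
proof -
  have u: "uS \<theta> 1 b = uS \<theta> 0 b" for b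
    by (rule uS_message)
  show ?thesis
    using u by (cases \<theta>)
      (simp_all add: sender_payoff_def deception_prob_def detector_def pmf_bit_zero algebra_simps)
qed

section \<open>Existence and exclusion of pooling equilibria\<close>

text \<open>
  The strict inequality also makes the observation \<open>(m, e)\<close> possible when both types send \<open>m\<close>;
  otherwise Bayes' law would leave the belief there free.
\<close>

definition favours :: "bit pmf \<Rightarrow> bit \<Rightarrow> bit \<Rightarrow> bit \<Rightarrow> bool" where
  "favours prior m e a \<longleftrightarrow>
     detector \<alpha> \<beta> e (1 - a) m * pmf prior (1 - a) * gain (1 - a)
       < detector \<alpha> \<beta> e a m * pmf prior a * gain a"

text \<open>Under pooling the message carries no information, so the posterior is \<open>?w\<close>
  divided by \<open>?P\<close>; a positive divisor preserves the sign of the comparison.\<close>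

lemma posterior_advantage:
  assumes pools: "pools_on \<sigma>S m"
    and bayes: "bayes_consistent_at prior \<alpha> \<beta> \<sigma>S \<mu> m e"
    and favours: "favours prior m e a"
  shows "0 < advantage (\<mu> m e) a"
proof -
  let ?w = "\<lambda>\<theta>. detector \<alpha> \<beta> e \<theta> m * pmf prior \<theta>"
  let ?P = "observation_prob prior \<alpha> \<beta> \<sigma>S m e"
  have pool: "pmf (\<sigma>S \<theta>) m = 1" for \<theta>
    using pools by (simp add: pools_on_def)
  have P: "?P = ?w a + ?w (1 - a)"
    unfolding observation_prob_def sum_bit[of _ a] by (simp add: pool)
  have nonneg: "0 \<le> ?w \<theta>" for \<theta>
    using detector_nonneg by simp
  have "0 \<le> ?w (1 - a) * gain (1 - a)"
    by (intro mult_nonneg_nonneg nonneg less_imp_le gain_pos)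
  then have "0 < ?w a * gain a"
    using favours by (simp add: favours_def)
  then have "0 < ?w a"
    using gain_pos[of a] by (simp add: zero_less_mult_iff)
  then have pos: "0 < ?P"
    using P nonneg[of "1 - a"] by linarith
  have post: "pmf (\<mu> m e) \<theta> = ?w \<theta> / ?P" for \<theta>
    using bayes pos by (simp add: bayes_consistent_at_def pool)
  have "advantage (\<mu> m e) a = (?w a * gain a - ?w (1 - a) * gain (1 - a)) / ?P"
    by (simp add: advantage_def post diff_divide_distrib)
  then show ?thesis
    using favours pos by (simp add: favours_def)
qed

lemma pooling_supportedI:
  assumes "\<forall>e. favours prior m e a"
  shows "pooling_supported prior \<alpha> \<beta> uS uR m a"
  unfolding pooling_supported_def
proof (intro allI impI)
  fix \<sigma>S :: sender_strategy and \<sigma>R :: receiver_strategy and \<mu> :: belief_system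
  assume pools: "pools_on \<sigma>S m"
    and act: "\<forall>m' e. pmf (\<sigma>R m' e) a = 1"
    and bayes: "\<forall>e. bayes_consistent_at prior \<alpha> \<beta> \<sigma>S \<mu> m e"
    and off: "\<forall>e. gain (1 - a) / (gain (1 - a) + gain a) \<le> pmf (\<mu> (1 - m) e) a"
  have off_path: "0 \<le> advantage (\<mu> (1 - m) e) a" for e
  proof -
    \<comment> \<open>The off-path threshold is the belief at which the receiver is
      indifferent.\<close>
    have "gain (1 - a) \<le> pmf (\<mu> (1 - m) e) a * (gain (1 - a) + gain a)"
      using off gain_pos by (simp add: pos_divide_le_eq add_pos_pos)
    then show ?thesis
      by (simp add: advantage_def pmf_bit_diff algebra_simps)
  qed
  have on_path: "0 \<le> advantage (\<mu> m e) a" for e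
    using posterior_advantage[OF pools bayes[rule_format] assms[rule_format]] by (rule less_imp_le)
  have adv: "0 \<le> advantage (\<mu> m' e) a" for m' e
    using on_path off_path by (cases "m' = m") (cases m; cases m'; auto)+
  have bayes': "bayes_consistent_at prior \<alpha> \<beta> \<sigma>S \<mu> m' e" for m' e
  proof (cases "m' = m")
    case False
    \<comment> \<open>A message that is never sent satisfies Bayes' law vacuously.\<close>
    have "pmf (\<sigma>S \<theta>) m' = 0" for \<theta>
      using pools False pmf_bit_diff[of "\<sigma>S \<theta>" m]
      by (cases m; cases m') (auto simp: pools_on_def)
    then have "observation_prob prior \<alpha> \<beta> \<sigma>S m' e = 0"
      by (simp add: observation_prob_def)
    then show ?thesis
      by (simp add: bayes_consistent_at_def)
  qed (use bayes in simp)
  have dec: "deception_prob \<sigma>R \<theta> m' = (if \<theta> = a then 0 else 1)" for \<theta> m'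
  proof -
    have "pmf (\<sigma>R m' e) (1 - \<theta>) = (if \<theta> = a then 0 else 1)" for e
      using act pmf_bit_diff[of "\<sigma>R m' e" a] by (cases a; cases \<theta>) auto
    then show ?thesis
      using detector_sum[of \<theta> m'] by (simp add: deception_prob_def)
  qed
  have "sender_payoff \<alpha> \<beta> uS \<sigma>R \<theta> \<sigma>S' \<le> sender_payoff \<alpha> \<beta> uS \<sigma>R \<theta> \<sigma>S" for \<theta> \<sigma>S'
    by (simp add: sender_payoff_eq dec pmf_bit_zero)
  then show "PBNE prior \<alpha> \<beta> uS uR \<sigma>S \<sigma>R \<mu>"
    using receiver_optimal[OF adv] act bayes' by (simp add: PBNE_def)
qed

text \<open>Compare with the deviation that sends \<open>m'\<close> for sure; the factor in front of
  the deception probability is positive.\<close>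

lemma pooling_sender_optimal:
  assumes "PBNE prior \<alpha> \<beta> uS uR \<sigma>S \<sigma>R \<mu>" and "pools_on \<sigma>S m"
  shows "deception_prob \<sigma>R \<theta> m' \<le> deception_prob \<sigma>R \<theta> m"
proof -
  have "sender_payoff \<alpha> \<beta> uS \<sigma>R \<theta> (\<lambda>_. return_pmf m') \<le> sender_payoff \<alpha> \<beta> uS \<sigma>R \<theta> \<sigma>S"
    using assms(1) by (simp add: PBNE_def)
  moreover have "(\<Sum>x\<in>{0, 1}. pmf (\<sigma>S \<theta>) x * deception_prob \<sigma>R \<theta> x) = deception_prob \<sigma>R \<theta> m"
    using assms(2) unfolding sum_bit[of _ m] by (simp add: pools_on_def pmf_bit_diff)
  moreover have "(\<Sum>x\<in>{0, 1}. pmf (return_pmf m') x * deception_prob \<sigma>R \<theta> x)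
      = deception_prob \<sigma>R \<theta> m'"
    unfolding sum_bit[of _ m'] by (simp add: pmf_bit_diff)
  ultimately show ?thesis
    using sender_mismatches[of \<theta> 0] by (simp add: sender_payoff_eq)
qed

text \<open>
  The action \<open>m + e\<close> (addition modulo 2) trusts the message when there is no alarm and
  contradicts it otherwise. Adding the no-deviation conditions of the two types forces the
  receiver to follow the same rule after the other message; the types then compare \<open>\<alpha>\<close> with
  \<open>1 - \<beta>\<close> in opposite directions, which leaves only \<open>\<beta> = 1 - \<alpha>\<close>.
\<close>

lemma pooling_not_supportedI:
  assumes favours: "\<forall>e. favours prior m e (m + e)"
    and generic: "\<beta> \<noteq> 1 - \<alpha>"
  shows "pooling_not_supported prior \<alpha> \<beta> uS uR m"
  unfolding pooling_not_supported_def
proof (intro notI, elim exE conjE)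
  fix \<sigma>S \<sigma>R \<mu>
  assume eq: "PBNE prior \<alpha> \<beta> uS uR \<sigma>S \<sigma>R \<mu>" and pools: "pools_on \<sigma>S m"
  have on: "pmf (\<sigma>R m e) (m + e) = 1" for e
  proof (rule receiver_optimal_imp_pure)
    show "0 < advantage (\<mu> m e) (m + e)"
      using eq by (intro posterior_advantage[OF pools _ favours[rule_format]]) (simp add: PBNE_def)
  qed (use eq in \<open>simp add: PBNE_def\<close>)
  \<comment> \<open>These are the probabilities of contradicting the unsent message
    \<open>1 - m\<close> without and with an alarm. Below, \<open>truthful\<close> is the
    no-deviation condition of type \<open>m\<close> and \<open>lying\<close> that of type
    \<open>1 - m\<close>.\<close>
  define r0 r1 where "r0 = pmf (\<sigma>R (1 - m) 0) m" and "r1 = pmf (\<sigma>R (1 - m) 1) m"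
  have truthful: "\<beta> * (1 - r1) + (1 - \<beta>) * (1 - r0) \<le> \<alpha>"
    using pooling_sender_optimal[OF eq pools, of m "1 - m"] on[of 0] on[of 1]
      pmf_bit_diff[of "\<sigma>R (1 - m) 0" m] pmf_bit_diff[of "\<sigma>R (1 - m) 1" m]
    by (cases m) (auto simp: deception_prob_def detector_def r0_def r1_def pmf_bit_zero)
  have lying: "\<alpha> * r1 + (1 - \<alpha>) * r0 \<le> 1 - \<beta>"
    using pooling_sender_optimal[OF eq pools, of "1 - m" "1 - m"] on[of 0] on[of 1]
      pmf_bit_diff[of "\<sigma>R (1 - m) 0" m] pmf_bit_diff[of "\<sigma>R (1 - m) 1" m]
    by (cases m) (auto simp: deception_prob_def detector_def r0_def r1_def pmf_bit_zero)
  have range: "0 \<le> r0" "r1 \<le> 1"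
    by (auto simp: r0_def r1_def pmf_le_1)
  have "(\<beta> - \<alpha>) * (1 + r0 - r1) \<le> 0"
    using truthful lying by (simp add: algebra_simps)
  then have "1 + r0 \<le> r1"
    using detector_rates by (simp add: mult_le_0_iff)
  then have "r0 = 0" "r1 = 1"
    using range by auto
  then show False
    using truthful lying generic by simp
qed

end

section \<open>Ordering of the cutoffs and the prior regions\<close>

theorem theorem1:
  fixes prior :: "bit pmf" and \<alpha> \<beta> p \<Delta>0 \<Delta>1 T1 T2 T3 T4 :: real and uS uR :: utility
  assumes rates: "0 \<le> \<alpha>" "\<alpha> < \<beta>" "\<beta> \<le> 1" "\<beta> \<noteq> 1 - \<alpha>"
    and prior: "p = pmf prior 1"
    and cheap_talk: "\<And>\<theta> m m' a. uS \<theta> m a = uS \<theta> m' a" "\<And>\<theta> m m' a. uR \<theta> m a = uR \<theta> m' a"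
    and receiver: "\<And>m. uR 0 m 0 > uR 0 m 1" "\<And>m. uR 1 m 1 > uR 1 m 0"
    and sender: "\<And>m. uS 0 m 0 < uS 0 m 1" "\<And>m. uS 1 m 0 > uS 1 m 1"
    and gains: "\<Delta>0 = receiver_gain uR 0" "\<Delta>1 = receiver_gain uR 1"
    and T1: "T1 = \<alpha> * \<Delta>0 / (\<alpha> * \<Delta>0 + \<beta> * \<Delta>1)"
    and T2: "T2 = (1 - \<beta>) * \<Delta>0 / ((1 - \<beta>) * \<Delta>0 + (1 - \<alpha>) * \<Delta>1)"
    and T3: "T3 = (1 - \<alpha>) * \<Delta>0 / ((1 - \<alpha>) * \<Delta>0 + (1 - \<beta>) * \<Delta>1)"
    and T4: "T4 = \<beta> * \<Delta>0 / (\<beta> * \<Delta>0 + \<alpha> * \<Delta>1)"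
  shows
    "(\<beta> < 1 - \<alpha> \<longrightarrow>
        (p < T1 \<longrightarrow>
           pooling_supported prior \<alpha> \<beta> uS uR 0 0 \<and> pooling_supported prior \<alpha> \<beta> uS uR 1 0) \<and>
        (T1 < p \<and> p < T2 \<longrightarrow>
           pooling_supported prior \<alpha> \<beta> uS uR 1 0 \<and> pooling_not_supported prior \<alpha> \<beta> uS uR 0) \<and>
        (T2 < p \<and> p < T3 \<longrightarrow>
           pooling_not_supported prior \<alpha> \<beta> uS uR 0 \<and> pooling_not_supported prior \<alpha> \<beta> uS uR 1) \<and>
        (T3 < p \<and> p < T4 \<longrightarrow>
           pooling_supported prior \<alpha> \<beta> uS uR 0 1 \<and> pooling_not_supported prior \<alpha> \<beta> uS uR 1) \<and>
        (T4 < p \<longrightarrow>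
           pooling_supported prior \<alpha> \<beta> uS uR 0 1 \<and> pooling_supported prior \<alpha> \<beta> uS uR 1 1))
     \<and>
     (1 - \<alpha> < \<beta> \<longrightarrow>
        (p < T2 \<longrightarrow>
           pooling_supported prior \<alpha> \<beta> uS uR 0 0 \<and> pooling_supported prior \<alpha> \<beta> uS uR 1 0) \<and>
        (T2 < p \<and> p < T1 \<longrightarrow>
           pooling_supported prior \<alpha> \<beta> uS uR 0 0 \<and> pooling_not_supported prior \<alpha> \<beta> uS uR 1) \<and>
        (T1 < p \<and> p < T4 \<longrightarrow>
           pooling_not_supported prior \<alpha> \<beta> uS uR 0 \<and> pooling_not_supported prior \<alpha> \<beta> uS uR 1) \<and>
        (T4 < p \<and> p < T3 \<longrightarrow>
           pooling_supported prior \<alpha> \<beta> uS uR 1 1 \<and> pooling_not_supported prior \<alpha> \<beta> uS uR 0) \<and>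
        (T3 < p \<longrightarrow>
           pooling_supported prior \<alpha> \<beta> uS uR 0 1 \<and> pooling_supported prior \<alpha> \<beta> uS uR 1 1))"
proof -
  interpret evidence_game \<alpha> \<beta> uS uR
  proof
    show "uR \<theta> m (1 - \<theta>) < uR \<theta> m \<theta>" and "uS \<theta> m \<theta> < uS \<theta> m (1 - \<theta>)" for \<theta> m
      using receiver sender by (cases \<theta>; simp)+
  qed (use rates cheap_talk in auto)
  have \<Delta>: "0 < \<Delta>0" "0 < \<Delta>1"
    using gain_pos gains by auto
  \<comment> \<open>Positive even for \<alpha> = 0 or \<beta> = 1, since \<alpha> < \<beta> gives 0
    < \<beta> and \<alpha> < 1.\<close>
  have den:
    "0 < \<alpha> * \<Delta>0 + \<beta> * \<Delta>1" "0 < (1 - \<beta>) * \<Delta>0 + (1 - \<alpha>) * \<Delta>1"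
    "0 < (1 - \<alpha>) * \<Delta>0 + (1 - \<beta>) * \<Delta>1" "0 < \<beta> * \<Delta>0 + \<alpha> * \<Delta>1"
    using rates \<Delta> by (simp_all add: add_nonneg_pos add_pos_nonneg)
  have p0: "pmf prior 0 = 1 - p"
    using prior by (simp add: pmf_bit_zero)
  note cut = cutoff_iff[OF den(1), of p, folded T1] cutoff_iff[OF den(2), of p, folded T2]
    cutoff_iff[OF den(3), of p, folded T3] cutoff_iff[OF den(4), of p, folded T4]
  have fav:
    "favours prior 0 0 0 \<longleftrightarrow> p < T3" "favours prior 0 1 0 \<longleftrightarrow> p < T1"
    "favours prior 1 0 0 \<longleftrightarrow> p < T2" "favours prior 1 1 0 \<longleftrightarrow> p < T4"
    "favours prior 0 0 1 \<longleftrightarrow> T3 < p" "favours prior 0 1 1 \<longleftrightarrow> T1 < p"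
    "favours prior 1 0 1 \<longleftrightarrow> T2 < p" "favours prior 1 1 1 \<longleftrightarrow> T4 < p"
    unfolding cut by (simp_all add: favours_def detector_def p0 flip: prior gains)
  \<comment> \<open>Message 0 is governed by \<open>T1\<close> and \<open>T3\<close>, message 1 by
    \<open>T2\<close> and \<open>T4\<close>: outside the two cutoffs the action is constant, between
    them it follows \<open>m + e\<close>.\<close>
  have zero_zero: "pooling_supported prior \<alpha> \<beta> uS uR 0 0" if "p < T1" "p < T3"
    using that by (intro pooling_supportedI) (simp add: all_bit fav)
  have one_zero: "pooling_supported prior \<alpha> \<beta> uS uR 1 0" if "p < T2" "p < T4"
    using that by (intro pooling_supportedI) (simp add: all_bit fav)
  have zero_one: "pooling_supported prior \<alpha> \<beta> uS uR 0 1" if "T1 < p" "T3 < p"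
    using that by (intro pooling_supportedI) (simp add: all_bit fav)
  have one_one: "pooling_supported prior \<alpha> \<beta> uS uR 1 1" if "T2 < p" "T4 < p"
    using that by (intro pooling_supportedI) (simp add: all_bit fav)
  have not_zero: "pooling_not_supported prior \<alpha> \<beta> uS uR 0" if "T1 < p" "p < T3"
    using that rates(4) by (intro pooling_not_supportedI) (simp_all add: all_bit fav)
  have not_one: "pooling_not_supported prior \<alpha> \<beta> uS uR 1" if "T2 < p" "p < T4"
    using that rates(4) by (intro pooling_not_supportedI) (simp_all add: all_bit fav)
  have T13: "T1 \<le> T3" and T24: "T2 \<le> T4"
    unfolding T1 T2 T3 T4 using rates by (intro cutoff_mono den \<Delta>; simp add: algebra_simps)+
  have T14: "T1 \<le> T4" and T23: "T2 \<le> T3"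
    unfolding T1 T2 T3 T4 using rates by (intro cutoff_mono den \<Delta> mult_mono; simp)+
  \<comment> \<open>Comparing \<open>T1\<close> with \<open>T2\<close>, and \<open>T3\<close> with
    \<open>T4\<close>, both reduce to \<alpha>(1 - \<alpha>) against \<beta>(1 - \<beta>), hence to
    the sign of 1 - \<alpha> - \<beta>.\<close>
  have spread: "\<beta> * (1 - \<beta>) - \<alpha> * (1 - \<alpha>) = (\<beta> - \<alpha>) * (1 - \<alpha> - \<beta>)"
    by (simp add: algebra_simps)
  have low: "T1 \<le> T2 \<and> T3 \<le> T4" if "\<beta> < 1 - \<alpha>"
  proof -
    have "0 \<le> (\<beta> - \<alpha>) * (1 - \<alpha> - \<beta>)"
      using rates that by (intro mult_nonneg_nonneg) auto
    then show ?thesis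
      unfolding T1 T2 T3 T4 using spread
      by (intro conjI cutoff_mono den \<Delta>; simp add: mult.commute)
  qed
  have high: "T2 \<le> T1 \<and> T4 \<le> T3" if "1 - \<alpha> < \<beta>"
  proof -
    have "(\<beta> - \<alpha>) * (1 - \<alpha> - \<beta>) \<le> 0"
      using rates that by (intro mult_nonneg_nonpos) auto
    then show ?thesis
      unfolding T1 T2 T3 T4 using spread
      by (intro conjI cutoff_mono den \<Delta>; simp add: mult.commute)
  qed
  show ?thesis
    \<comment> \<open>Each region bounds \<open>p\<close> by adjacent cutoffs; the orderings supply
      the remaining comparisons.\<close>
    by (intro conjI impI zero_zero one_zero zero_one one_one not_zero not_one;
        (drule low | drule high); use T13 T24 T14 T23 in auto)
qed

end
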